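(* The function $\exp$ is an epimorphism (i.e. a surjective map) from $\mathbf H_i:=\{z\in\mathbf H:\ \mathrm{Re}(z_{1,1})=0\}$ onto the three-dimensional quaternion unit sphere $S^3(0,1,\mathbf H):=\{z\in\mathbf H:\ |z|=1\}$.
   Context: $\mathbf H$ is the quaternion skew field realized as the matrices $z=\begin{pmatrix}t&u\\-\bar u&\bar t\end{pmatrix}$, $t,u\in\mathbf C$, $z_{1,1}=t$; $|z|=(|t|^2+|u|^2)^{1/2}$. Thus $\mathbf H_i$ is the set of purely imaginary quaternions. $\exp(z):=\sum_{n=0}^\infty z^n/n!$. *)

theory Defs
  imports "HOL-Analysis.Analysis"
begin

definition quat_mat :: "complex \<Rightarrow> complex \<Rightarrow> complex^2^2" where
  "quat_mat t u = vector [vector [t, u], vector [- cnj u, cnj t]]"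

lemma quat_mat_nth [simp]:
  "quat_mat t u $ 1 $ 1 = t" "quat_mat t u $ 1 $ 2 = u"
  "quat_mat t u $ 2 $ 1 = - cnj u" "quat_mat t u $ 2 $ 2 = cnj t"
  by (simp_all add: quat_mat_def)

lemma mat2_eq_iff:
  fixes A B :: "complex^2^2"
  shows "A = B \<longleftrightarrow> A $ 1 $ 1 = B $ 1 $ 1 \<and> A $ 1 $ 2 = B $ 1 $ 2 \<and>
           A $ 2 $ 1 = B $ 2 $ 1 \<and> A $ 2 $ 2 = B $ 2 $ 2"
  by (auto simp: vec_eq_iff forall_2)

typedef quat = "{quat_mat t u | t u. True}"
  morphisms mat_of_quat quat_of_mat
  by blast

setup_lifting type_definition_quat

lemma quat_mat_ops:
  "0 = quat_mat 0 0" "mat 1 = quat_mat 1 0"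
  "quat_mat t u + quat_mat t' u' = quat_mat (t + t') (u + u')"
  "quat_mat t u - quat_mat t' u' = quat_mat (t - t') (u - u')"
  "- quat_mat t u = quat_mat (- t) (- u)"
  "quat_mat t u ** quat_mat t' u' = quat_mat (t * t' - u * cnj u') (t * u' + u * cnj t')"
  "r *\<^sub>R quat_mat t u = quat_mat (r *\<^sub>R t) (r *\<^sub>R u)"
  by (simp_all add: mat2_eq_iff mat_def matrix_matrix_mult_def sum_2)

text \<open>The ring operations are those of the matrix ring; on vectors of vectors the product
  is \<open>**\<close>, since \<open>*\<close> would be componentwise.\<close>

instantiation quat :: "{zero, one, plus, minus, uminus, times, scaleR}"
begin

lift_definition zero_quat :: quat is "0 :: complex^2^2"
  using quat_mat_ops(1) by blast

lift_definition one_quat :: quat is "mat 1 :: complex^2^2"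
  using quat_mat_ops(2) by blast

lift_definition plus_quat :: "quat \<Rightarrow> quat \<Rightarrow> quat" is "\<lambda>x y. x + y"
  using quat_mat_ops(3) by blast

lift_definition minus_quat :: "quat \<Rightarrow> quat \<Rightarrow> quat" is "\<lambda>x y. x - y"
  using quat_mat_ops(4) by blast

lift_definition uminus_quat :: "quat \<Rightarrow> quat" is "\<lambda>x. - x"
  using quat_mat_ops(5) by blast

lift_definition times_quat :: "quat \<Rightarrow> quat \<Rightarrow> quat" is "\<lambda>x y. x ** y"
  using quat_mat_ops(6) by blast

lift_definition scaleR_quat :: "real \<Rightarrow> quat \<Rightarrow> quat" is "\<lambda>r x. r *\<^sub>R x"
  using quat_mat_ops(7) by blast

instance ..

end

definition quat_t :: "quat \<Rightarrow> complex" where "quat_t z = mat_of_quat z $ 1 $ 1"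
definition quat_u :: "quat \<Rightarrow> complex" where "quat_u z = mat_of_quat z $ 1 $ 2"

lemma mat_of_quat_eq: "mat_of_quat z = quat_mat (quat_t z) (quat_u z)"
  using mat_of_quat[of z] by (auto simp: quat_t_def quat_u_def)

lemma quat_eqI: "quat_t x = quat_t y \<Longrightarrow> quat_u x = quat_u y \<Longrightarrow> x = y"
  by (metis mat_of_quat_eq mat_of_quat_inject)

lemma quat_t_u_of_mat [simp]:
  "quat_t (quat_of_mat (quat_mat t u)) = t" "quat_u (quat_of_mat (quat_mat t u)) = u"
  unfolding quat_t_def quat_u_def by (subst quat_of_mat_inverse; auto)+

lemma quat_t_simps [simp]:
  "quat_t 0 = 0" "quat_t 1 = 1" "quat_t (x + y) = quat_t x + quat_t y"
  "quat_t (x - y) = quat_t x - quat_t y" "quat_t (- x) = - quat_t x"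
  "quat_t (x * y) = quat_t x * quat_t y - quat_u x * cnj (quat_u y)"
  "quat_t (r *\<^sub>R x) = r *\<^sub>R quat_t x"
  unfolding quat_t_def[of 0] quat_t_def[of 1] quat_t_def[of "x + y"] quat_t_def[of "x - y"]
    quat_t_def[of "- x"] quat_t_def[of "x * y"] quat_t_def[of "r *\<^sub>R x"]
    zero_quat.rep_eq one_quat.rep_eq plus_quat.rep_eq minus_quat.rep_eq
    uminus_quat.rep_eq times_quat.rep_eq scaleR_quat.rep_eq
    mat_of_quat_eq[of x] mat_of_quat_eq[of y]
  by (simp_all add: mat_def matrix_matrix_mult_def sum_2)

lemma quat_u_simps [simp]:
  "quat_u 0 = 0" "quat_u 1 = 0" "quat_u (x + y) = quat_u x + quat_u y"
  "quat_u (x - y) = quat_u x - quat_u y" "quat_u (- x) = - quat_u x"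
  "quat_u (x * y) = quat_t x * quat_u y + quat_u x * cnj (quat_t y)"
  "quat_u (r *\<^sub>R x) = r *\<^sub>R quat_u x"
  unfolding quat_u_def[of 0] quat_u_def[of 1] quat_u_def[of "x + y"] quat_u_def[of "x - y"]
    quat_u_def[of "- x"] quat_u_def[of "x * y"] quat_u_def[of "r *\<^sub>R x"]
    zero_quat.rep_eq one_quat.rep_eq plus_quat.rep_eq minus_quat.rep_eq
    uminus_quat.rep_eq times_quat.rep_eq scaleR_quat.rep_eq
    mat_of_quat_eq[of x] mat_of_quat_eq[of y]
  by (simp_all add: mat_def matrix_matrix_mult_def sum_2)

instance quat :: real_algebra_1
proof
  show "(0 :: quat) \<noteq> 1"
    by (metis quat_t_simps(1,2) zero_neq_one)
qed (rule quat_eqI; simp add: algebra_simps)+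

instantiation quat :: real_normed_div_algebra
begin

definition norm_quat :: "quat \<Rightarrow> real" where
  "norm z = sqrt ((cmod (mat_of_quat z $ 1 $ 1))\<^sup>2 + (cmod (mat_of_quat z $ 1 $ 2))\<^sup>2)"

definition inverse_quat :: "quat \<Rightarrow> quat" where
  "inverse z = (1 / (norm z)\<^sup>2) *\<^sub>R
     quat_of_mat (quat_mat (cnj (mat_of_quat z $ 1 $ 1)) (- (mat_of_quat z $ 1 $ 2)))"

definition divide_quat :: "quat \<Rightarrow> quat \<Rightarrow> quat" where
  "divide_quat x y = x * inverse y"

definition sgn_quat :: "quat \<Rightarrow> quat" where
  "sgn_quat x = x /\<^sub>R norm x"

definition dist_quat :: "quat \<Rightarrow> quat \<Rightarrow> real" where
  "dist_quat x y = norm (x - y)"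

definition uniformity_quat :: "(quat \<times> quat) filter" where
  "uniformity_quat = (INF e\<in>{0 <..}. principal {(x, y). dist x y < e})"

definition open_quat :: "quat set \<Rightarrow> bool" where
  "open_quat U \<longleftrightarrow> (\<forall>x\<in>U. eventually (\<lambda>(x', y). x' = x \<longrightarrow> y \<in> U) uniformity)"

lemma norm_quat_Pair: "norm z = norm (quat_t z, quat_u z)"
  by (simp add: norm_quat_def norm_Pair quat_t_def quat_u_def)

lemma norm_quat_sq:
  "complex_of_real ((norm z)\<^sup>2) = quat_t z * cnj (quat_t z) + quat_u z * cnj (quat_u z)"
  by (simp add: norm_quat_def quat_t_def quat_u_def complex_norm_square del: of_real_power)

instance
proof
  fix x y :: quat and r :: real
  show norm0: "(norm x = 0) = (x = 0)" for x :: quat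
    by (auto simp: norm_quat_Pair zero_prod_def intro: quat_eqI)
  show "norm (x + y) \<le> norm x + norm y"
    using norm_triangle_ineq[of "(quat_t x, quat_u x)" "(quat_t y, quat_u y)"]
    by (simp add: norm_quat_Pair)
  show "norm (r *\<^sub>R x) = \<bar>r\<bar> * norm x"
    using norm_scaleR[of r "(quat_t x, quat_u x)"] by (simp add: norm_quat_Pair)
  have "complex_of_real ((norm (x * y))\<^sup>2) = complex_of_real ((norm x * norm y)\<^sup>2)"
    unfolding power_mult_distrib of_real_mult norm_quat_sq by (simp add: algebra_simps)
  then have "(norm (x * y))\<^sup>2 = (norm x * norm y)\<^sup>2"
    using of_real_eq_iff by blast
  moreover have "norm z \<ge> 0" for z :: quat by (simp add: norm_quat_def)
  ultimately show "norm (x * y) = norm x * norm y"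
    by (simp add: power2_eq_iff_nonneg)
  have inv_t: "quat_t (inverse z) = cnj (quat_t z) / complex_of_real ((norm z)\<^sup>2)" for z
    by (simp add: inverse_quat_def quat_t_def[symmetric] quat_u_def[symmetric]
        scaleR_conv_of_real[where 'a = complex])
  have inv_u: "quat_u (inverse z) = - quat_u z / complex_of_real ((norm z)\<^sup>2)" for z
    by (simp add: inverse_quat_def quat_t_def[symmetric] quat_u_def[symmetric]
        scaleR_conv_of_real[where 'a = complex])
  have nz: "complex_of_real ((norm x)\<^sup>2) \<noteq> 0" if "x \<noteq> 0"
    using that norm0 by simp
  show "inverse x * x = 1" if "x \<noteq> 0"
    using nz[OF that]
    by (intro quat_eqI; simp add: inv_t inv_u divide_simps del: of_real_power;
        simp add: norm_quat_sq algebra_simps del: of_real_power)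
  show "x * inverse x = 1" if "x \<noteq> 0"
    using nz[OF that]
    by (intro quat_eqI; simp add: inv_t inv_u divide_simps del: of_real_power;
        simp add: norm_quat_sq algebra_simps del: of_real_power)
  show "inverse (0 :: quat) = 0"
    by (rule quat_eqI) (simp_all add: inv_t inv_u)
qed (simp_all add: divide_quat_def sgn_quat_def dist_quat_def uniformity_quat_def open_quat_def)

end

instance quat :: banach
proof
  fix X :: "nat \<Rightarrow> quat"
  assume "Cauchy X"
  let ?Y = "\<lambda>n. (quat_t (X n), quat_u (X n))"
  have d: "dist x y = dist (quat_t x, quat_u x) (quat_t y, quat_u y)" for x y
    by (simp add: dist_norm norm_quat_Pair)
  have "Cauchy ?Y"
    using \<open>Cauchy X\<close> unfolding Cauchy_def d .
  then obtain t u where "?Y \<longlonglongrightarrow> (t, u)"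
    by (metis Cauchy_convergent convergentD surj_pair)
  then have "X \<longlonglongrightarrow> quat_of_mat (quat_mat t u)"
    unfolding lim_sequentially d by simp
  then show "convergent X"
    by (rule convergentI)
qed

end

theory Submission
  imports Defs
begin

text \<open>A purely imaginary unit quaternion \<open>q\<close> satisfies \<open>q\<^sup>2 = -1\<close>, so \<open>a + b \<i> \<mapsto> a + b q\<close> is a
  continuous algebra homomorphism from the complex numbers to the quaternions. It therefore
  commutes with \<open>exp\<close>, giving \<open>exp (\<theta> q) = cos \<theta> + sin \<theta> q\<close>. Every purely imaginary quaternion
  is a real multiple of such a \<open>q\<close>, and every unit quaternion has the form \<open>a + b q\<close> with
  \<open>a\<^sup>2 + b\<^sup>2 = 1\<close>.\<close>

lemma exp_bounded_linear_mult:
  fixes f :: "'a::{real_normed_algebra_1,banach} \<Rightarrow> 'b::{real_normed_algebra_1,banach}"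
  assumes "bounded_linear f" and one: "f 1 = 1" and mult: "\<And>x y. f (x * y) = f x * f y"
  shows "exp (f x) = f (exp x)"
proof -
  interpret bounded_linear f by fact
  have "f (x ^ n) = f x ^ n" for n
    by (induction n) (simp_all add: one mult)
  \<comment> \<open>Linearity and continuity let \<open>f\<close> pass through the exponential
    series term by term.\<close>
  then have "(\<lambda>n. f x ^ n /\<^sub>R fact n) sums f (exp x)"
    using sums[OF exp_converges[of x]] by (simp add: scaleR)
  then show ?thesis
    using exp_converges sums_unique2 by blast
qed

lemma exp_scaleR_imaginary_unit:
  fixes q :: "'a::{real_normed_algebra_1,banach}"
  assumes q: "q * q = - 1"
  shows "exp (\<theta> *\<^sub>R q) = cos \<theta> *\<^sub>R 1 + sin \<theta> *\<^sub>R q"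
proof -
  define f where "f w = Re w *\<^sub>R 1 + Im w *\<^sub>R q" for w
  have "bounded_linear f"
    unfolding f_def
    by (intro bounded_linear_add bounded_linear_scaleR_const bounded_linear_Re bounded_linear_Im)
  moreover have "f 1 = 1"
    by (simp add: f_def)
  moreover have "f (x * y) = f x * f y" for x y
    by (simp add: f_def algebra_simps q)
  ultimately have "exp (f (\<i> * \<theta>)) = f (exp (\<i> * \<theta>))"
    by (rule exp_bounded_linear_mult)
  then show ?thesis
    by (simp add: f_def Re_exp Im_exp)
qed

lemma norm_quat_power2:
  "(norm z)\<^sup>2 = (Re (quat_t z))\<^sup>2 + (Im (quat_t z))\<^sup>2 + (cmod (quat_u z))\<^sup>2"
  by (simp add: norm_quat_Pair norm_Pair cmod_power2)

text \<open>Pythagoras: \<open>q\<close> has no real part, so it is orthogonal to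
  \<open>1\<close>.\<close>

lemma norm_add_scaleR_imaginary_unit:
  assumes "Re (quat_t q) = 0" "norm q = 1"
  shows "(norm (a *\<^sub>R 1 + b *\<^sub>R q))\<^sup>2 = a\<^sup>2 + b\<^sup>2"
proof -
  have "(norm (a *\<^sub>R 1 + b *\<^sub>R q))\<^sup>2 = a\<^sup>2 + b\<^sup>2 * (norm q)\<^sup>2"
    using assms(1) by (simp add: norm_quat_power2 power_mult_distrib algebra_simps)
  then show ?thesis
    using assms(2) by simp
qed

text \<open>The quaternion conjugate of an imaginary \<open>q\<close> is \<open>- q\<close>, and
  \<open>q\<close> times its conjugate is the squared norm, here 1.\<close>

lemma imaginary_unit_quat_square:
  assumes "Re (quat_t q) = 0" "norm q = 1"
  shows "q * q = - 1"
proof (rule quat_eqI)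
  have cnj: "cnj (quat_t q) = - quat_t q"
    using assms(1) by (simp add: complex_eq_iff)
  then show "quat_t (q * q) = quat_t (- 1)"
    using norm_quat_sq[of q] assms(2) by (simp add: algebra_simps)
  show "quat_u (q * q) = quat_u (- 1)"
    using cnj by (simp add: algebra_simps)
qed

lemma imaginary_quat_polar:
  assumes z: "Re (quat_t z) = 0"
  obtains q where "Re (quat_t q) = 0" "norm q = 1" "z = norm z *\<^sub>R q"
proof (cases "z = 0")
  case True
  \<comment> \<open>Zero has no direction, so any imaginary unit serves.\<close>
  let ?q = "quat_of_mat (quat_mat \<i> 0)"
  have "norm ?q = 1"
    by (simp add: norm_quat_Pair norm_Pair)
  then show ?thesis
    using True that[of ?q] by simp
next
  case False
  then show ?thesis
    using z that[of "z /\<^sub>R norm z"] by simp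
qed

theorem corollary3p5:
  shows "exp ` {z :: quat. Re (mat_of_quat z $ 1 $ 1) = 0} = {z :: quat. norm z = 1}"
  unfolding quat_t_def[symmetric]
proof (intro equalityI subsetI; clarsimp)
  fix z :: quat
  assume "Re (quat_t z) = 0"
  then obtain q where q: "Re (quat_t q) = 0" "norm q = 1" and z: "z = norm z *\<^sub>R q"
    by (rule imaginary_quat_polar)
  have "exp z = cos (norm z) *\<^sub>R 1 + sin (norm z) *\<^sub>R q"
    using exp_scaleR_imaginary_unit[OF imaginary_unit_quat_square[OF q]] z by metis
  then have "(norm (exp z))\<^sup>2 = 1"
    using norm_add_scaleR_imaginary_unit[OF q] by simp
  then show "norm (exp z) = 1"
    using norm_ge_zero[of "exp z"] by (simp add: power2_eq_1_iff)
next
  fix z :: quat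
  assume z: "norm z = 1"
  define a where "a = Re (quat_t z)"
  \<comment> \<open>The imaginary part of \<open>z\<close>; its direction supplies
    \<open>q\<close>.\<close>
  define v where "v = z - a *\<^sub>R 1"
  have "Re (quat_t v) = 0"
    by (simp add: v_def a_def)
  then obtain q where q: "Re (quat_t q) = 0" "norm q = 1" and v: "v = norm v *\<^sub>R q"
    by (rule imaginary_quat_polar)
  have z_eq: "z = a *\<^sub>R 1 + norm v *\<^sub>R q"
    using v by (simp add: v_def)
  then have "a\<^sup>2 + (norm v)\<^sup>2 = 1"
    using norm_add_scaleR_imaginary_unit[OF q, of a "norm v"] z by simp
  \<comment> \<open>The point \<open>(a, norm v)\<close> lies on the unit circle, so it has an angle
    \<theta>, and \<open>\<theta> *\<^sub>R q\<close> is the preimage of \<open>z\<close>.\<close>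
  then obtain \<theta> where "a = cos \<theta>" "norm v = sin \<theta>"
    by (rule sincos_total_2pi) blast
  then have "z = exp (\<theta> *\<^sub>R q)"
    using z_eq exp_scaleR_imaginary_unit[OF imaginary_unit_quat_square[OF q]] by simp
  then show "z \<in> exp ` {z. Re (quat_t z) = 0}"
    using q(1) by auto
qed

end
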